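(* For each DG-problem with independent forces there exists an equivalent canonical DG-problem. Moreover, in both equivalent problems the centers of application of the forces belong to the same plane in the body containing the fixed point. Explicitly: let $\mathfrak{P}=(\mathbf I,\boldsymbol\lambda,A,C)$ be the parameter set of a DG-problem with independent forces. Then there exist $\Lambda\in SO(3)$ and $D\in GL(2,\mathbb R)$ such that the DG-problem with parameter set $\psi(\Lambda,D)(\mathfrak P)=(\mathbf I',\boldsymbol\lambda',A',C')$ is canonical, and $\Lambda\big(\mathrm{span}(\mathbf c_1(A),\mathbf c_2(A))\big)=\mathrm{span}(\mathbf c_1(A'),\mathbf c_2(A'))$ (a vector $\mathbf a$ fixed in the body in the first problem is represented, in the second problem, by $\Lambda\mathbf a$).
   Context: Notation. $L(n,k)$ is the space of real $n\times k$ matrices, $L(k)=L(k,k)$. For $\mathbf a_1,\mathbf a_2\in\mathbb R^3$, $j(\mathbf a_1,\mathbf a_2)\in L(3,2)$ is the matrix with columns $\mathbf a_1,\mathbf a_2$; for $A\in L(3,2)$, $\mathbf c_1(A),\mathbf c_2(A)\in\mathbb R^3$ are its columns. For $A,B\in L(3,2)$ and $\mathbf a\in\mathbb R^3$ put $A\times B=\sum_{i=1}^2\mathbf c_i(A)\times\mathbf c_i(B)\in\mathbb R^3$ and $\mathbf a\times A=j(\mathbf a\times\mathbf c_1(A),\mathbf a\times\mathbf c_2(A))\in L(3,2)$. $\mathbf e_1,\mathbf e_2,\mathbf e_3$ is the canonical basis of $\mathbb R^3$ (the moving trihedral attached to the body at the fixed point $O$). DG-problem. The motion of a gyrostat about a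 fixed point in two constant fields is described by $$\mathbf I\frac{d\boldsymbol\omega}{dt}=(\mathbf I\boldsymbol\omega+\boldsymbol\lambda)\times\boldsymbol\omega+A\times U,\qquad \frac{dU}{dt}=-\boldsymbol\omega\times U,$$ where $\boldsymbol\omega\in\mathbb R^3$, $\mathbf I\in L(3)$ is the (constant, symmetric positive definite) inertia tensor, $\boldsymbol\lambda\in\mathbb R^3$ is the constant gyrostatic momentum, $A=j(\mathbf r_1,\mathbf r_2)$ is the constant matrix of radius vectors of the centers of application of the fields, and $U=j(\boldsymbol\alpha,\boldsymbol\beta)$ is the matrix of field intensity vectors. $U$ is restricted by $U^TU=C$ with a constant symmetric matrix $C\in L(2)$; put $\mathcal O(C)=\{U\in L(3,2):U^TU=C\}$. Write $\mathfrak P=(\mathbf I,\boldsymbol\lambda,A,C)$ for the complete set of parameters and $X_{\mathfrak P}$ for the vector field induced on $\mathbb R^3\times\mathcal O(C)$. The dynamical system $X_{\mathfrak P}$ is called the DG-problem with parameters $\mathfrak P$. The two fields (forces) are independent if $\mathbf r_1\times\mathbf r_2\ne0$ and $\boldsymbol\alpha\times\boldsymbol\beta\ne0$ (the latter meaning that $C$ is positive definite). For $\Lambda\in SO(3)$, $D\in GL(2,\mathbb R)$ put $$\Psi(\Lambda,D)(\boldsymbol\omega,U)=(\Lambda\boldsymbol\omega,\Lambda UD^T),\qquad \psi(\Lambda,D)(\mathbf I,\boldsymbol\lambda,A,C)=(\Lambda\mathbf I\Lambda^T,\Lambda\boldsymbol\lambda,\Lambda AD^{-1},DCD^T).$$ The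 map $\Psi(\Lambda,D)$ carries $X_{\mathfrak P}$ to $X_{\psi(\Lambda,D)(\mathfrak P)}$, and the DG-problems with parameter sets $\mathfrak P$ and $\psi(\Lambda,D)(\mathfrak P)$ are called equivalent. A DG-problem is canonical if the centers of application of the forces lie on the first two axes of the moving trihedral at unit distance from $O$, i.e. $\mathbf r_1=\mathbf e_1$, $\mathbf r_2=\mathbf e_2$, and the intensities of the forces are orthogonal to each other, i.e. $\boldsymbol\alpha\cdot\boldsymbol\beta=0$ ($C$ is diagonal). *)

theory Defs
  imports "HOL-Analysis.Analysis"
begin

text \<open>
  \<open>L(n,k)\<close> is the type \<open>real ^ 'k ^ 'n\<close>, so an element of \<open>L(3,2)\<close> has type \<open>real ^ 2 ^ 3\<close>,
  and its columns are \<open>column 1 A\<close> and \<open>column 2 A\<close>.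
\<close>

definition jmat :: "real ^ 3 \<Rightarrow> real ^ 3 \<Rightarrow> real ^ 2 ^ 3" where
  "jmat a b = (\<chi> i k. if k = 1 then a $ i else b $ i)"

definition mat_cross :: "real ^ 2 ^ 3 \<Rightarrow> real ^ 2 ^ 3 \<Rightarrow> real ^ 3" where
  "mat_cross A B = (\<Sum>i\<in>UNIV. cross3 (column i A) (column i B))"

definition vec_mat_cross :: "real ^ 3 \<Rightarrow> real ^ 2 ^ 3 \<Rightarrow> real ^ 2 ^ 3" where
  "vec_mat_cross a A = jmat (cross3 a (column 1 A)) (cross3 a (column 2 A))"

definition sym_pos_def :: "real ^ 'n ^ 'n \<Rightarrow> bool" where
  "sym_pos_def M \<longleftrightarrow> transpose M = M \<and> (\<forall>x. x \<noteq> 0 \<longrightarrow> 0 < x \<bullet> (M *v x))"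

record dg_params =
  inertia :: "real ^ 3 ^ 3"
  gyro :: "real ^ 3"
  centers :: "real ^ 2 ^ 3"
  gram :: "real ^ 2 ^ 2"

definition dg_problem :: "dg_params \<Rightarrow> bool" where
  "dg_problem P \<longleftrightarrow> sym_pos_def (inertia P) \<and> transpose (gram P) = gram P"

definition orbit :: "real ^ 2 ^ 2 \<Rightarrow> (real ^ 2 ^ 3) set" where
  "orbit C = {U. transpose U ** U = C}"

text \<open>
  The vector field is written on the ambient space; its restriction to \<open>UNIV \<times> orbit (gram P)\<close>
  is the dynamical system with parameters \<open>P\<close>. Lemma \<open>dg_field_tangent\<close> shows that it is tangent
  to that set.
\<close>

definition dg_field :: "dg_params \<Rightarrow> (real ^ 3) \<times> (real ^ 2 ^ 3) \<Rightarrow> (real ^ 3) \<times> (real ^ 2 ^ 3)" where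
  "dg_field P = (\<lambda>(\<omega>, U).
     (matrix_inv (inertia P) *v
        (cross3 (inertia P *v \<omega> + gyro P) \<omega> + mat_cross (centers P) U),
      - vec_mat_cross \<omega> U))"

text \<open>
  Independence of the intensities is a condition on the Gram matrix; lemma
  \<open>intensities_independent_iff\<close> relates it to the vector product of the intensities.
\<close>

definition dg_independent :: "dg_params \<Rightarrow> bool" where
  "dg_independent P \<longleftrightarrow>
     cross3 (column 1 (centers P)) (column 2 (centers P)) \<noteq> 0 \<and> sym_pos_def (gram P)"

definition Psi :: "real ^ 3 ^ 3 \<Rightarrow> real ^ 2 ^ 2 \<Rightarrow> (real ^ 3) \<times> (real ^ 2 ^ 3) \<Rightarrow> (real ^ 3) \<times> (real ^ 2 ^ 3)" where
  "Psi \<Lambda> D = (\<lambda>(\<omega>, U). (\<Lambda> *v \<omega>, \<Lambda> ** U ** transpose D))"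

definition psi :: "real ^ 3 ^ 3 \<Rightarrow> real ^ 2 ^ 2 \<Rightarrow> dg_params \<Rightarrow> dg_params" where
  "psi \<Lambda> D P =
     \<lparr> inertia = \<Lambda> ** inertia P ** transpose \<Lambda>,
       gyro = \<Lambda> *v gyro P,
       centers = \<Lambda> ** centers P ** matrix_inv D,
       gram = D ** gram P ** transpose D \<rparr>"

text \<open>
  Orthogonality of the intensities is the vanishing of the off-diagonal entries of the Gram
  matrix (lemma \<open>orbit_inner_columns\<close>).
\<close>

definition dg_canonical :: "dg_params \<Rightarrow> bool" where
  "dg_canonical P \<longleftrightarrow>
     dg_problem P \<and>
     column 1 (centers P) = axis 1 1 \<and> column 2 (centers P) = axis 2 1 \<and>
     (\<forall>i j. i \<noteq> j \<longrightarrow> gram P $ i $ j = 0)"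

lemma orbit_inner_columns:
  assumes "U \<in> orbit C"
  shows "column i U \<bullet> column j U = C $ i $ j"
proof -
  have "C $ i $ j = (transpose U ** U) $ i $ j"
    using assms by (simp add: orbit_def)
  then show ?thesis
    by (simp add: inner_vec_def matrix_matrix_mult_def transpose_def column_def)
qed

lemma intensities_independent_iff:
  assumes "U \<in> orbit C"
  shows "cross3 (column 1 U) (column 2 U) \<noteq> 0 \<longleftrightarrow> sym_pos_def C"
proof -
  let ?a = "column 1 U" and ?b = "column 2 U"
  have C: "C = transpose U ** U"
    using assms by (simp add: orbit_def)
  have sym: "transpose C = C"
    by (simp add: C matrix_transpose_mul)
  have Ux: "U *v x = x $ 1 *\<^sub>R ?a + x $ 2 *\<^sub>R ?b" for x
    by (simp add: vec_eq_iff matrix_vector_mult_def column_def sum_2 mult.commute)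
  have quad: "x \<bullet> (C *v x) = (U *v x) \<bullet> (U *v x)" for x
    by (metis C dot_lmul_matrix matrix_vector_mul_assoc vector_transpose_matrix)
  have "sym_pos_def C \<longleftrightarrow> (\<forall>x. x \<noteq> 0 \<longrightarrow> U *v x \<noteq> 0)"
    by (simp add: sym_pos_def_def sym quad)
  also have "\<dots> \<longleftrightarrow> cross3 ?a ?b \<noteq> 0"
  proof
    assume inj: "\<forall>x. x \<noteq> 0 \<longrightarrow> U *v x \<noteq> 0"
    show "cross3 ?a ?b \<noteq> 0"
    proof
      assume "cross3 ?a ?b = 0"
      then consider "?a = 0" | c where "?b = c *\<^sub>R ?a"
        by (metis cross_eq_0 collinear_lemma scaleR_zero_left)
      then show False
      proof cases
        case 1
        then show False
          using inj[rule_format, of "vector [1, 0]"] Ux[of "vector [1, 0]"]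
          by (simp add: vec_eq_iff forall_2)
      next
        case (2 c)
        then show False
          using inj[rule_format, of "vector [c, -1]"] Ux[of "vector [c, -1]"]
          by (simp add: vec_eq_iff forall_2)
      qed
    qed
  next
    assume nz: "cross3 ?a ?b \<noteq> 0"
    show "\<forall>x. x \<noteq> 0 \<longrightarrow> U *v x \<noteq> 0"
    proof (intro allI impI notI)
      fix x :: "real ^ 2"
      assume x: "x \<noteq> 0" and "U *v x = 0"
      then have z: "x $ 1 *\<^sub>R ?a + x $ 2 *\<^sub>R ?b = 0"
        by (simp add: Ux)
      have "x $ 1 *\<^sub>R cross3 ?a ?b = cross3 (x $ 1 *\<^sub>R ?a + x $ 2 *\<^sub>R ?b) ?b"
        by (simp only: cross_add_left cross_mult_left cross_refl) simp
      moreover have "x $ 2 *\<^sub>R cross3 ?a ?b = cross3 ?a (x $ 1 *\<^sub>R ?a + x $ 2 *\<^sub>R ?b)"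
        by (simp only: cross_add_right cross_mult_right cross_refl) simp
      ultimately have "x $ 1 = 0" "x $ 2 = 0"
        using nz unfolding z by (simp_all only: cross_zero_left cross_zero_right scaleR_eq_0_iff) blast+
      then show False
        using x by (simp add: vec_eq_iff forall_2)
    qed
  qed
  finally show ?thesis
    by blast
qed

lemma column_matrix_mult: "column k (M ** U) = M *v column k U"
  by (simp add: vec_eq_iff column_def matrix_matrix_mult_def matrix_vector_mult_def)

lemma dg_field_tangent:
  assumes "dg_field P (\<omega>, U) = (\<omega>', U')"
  shows "transpose U' ** U + transpose U ** U' = 0"
proof -
  have "U' = - vec_mat_cross \<omega> U"
    using assms by (simp add: dg_field_def)
  then show ?thesis
    by (simp add: vec_mat_cross_def jmat_def matrix_matrix_mult_def transpose_def column_def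
        vec_eq_iff forall_2 sum_3 cross3_def) (simp add: algebra_simps)
qed

lemma orbit_Psi:
  assumes "rotation_matrix \<Lambda>" and "U \<in> orbit C"
  shows "snd (Psi \<Lambda> D (\<omega>, U)) \<in> orbit (D ** C ** transpose D)"
proof -
  have "transpose \<Lambda> ** \<Lambda> = mat 1"
    using assms by (simp add: rotation_matrix_def orthogonal_matrix_def)
  then have "transpose \<Lambda> ** (\<Lambda> ** V) = V" for V :: "real ^ 2 ^ 3"
    by (simp add: matrix_mul_assoc)
  moreover have "transpose U ** (U ** V) = C ** V" for V :: "real ^ 2 ^ 2"
    using assms by (simp add: orbit_def matrix_mul_assoc)
  ultimately show ?thesis
    by (simp add: orbit_def Psi_def matrix_transpose_mul matrix_mul_assoc[symmetric])
qed

lemma mat_cross_move: "mat_cross (A ** M) U = mat_cross A (U ** transpose M)"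
  by (simp add: mat_cross_def sum_2 matrix_matrix_mult_def transpose_def column_def
      vec_eq_iff forall_3 cross3_def) (simp add: algebra_simps)

lemma mat_cross_rotate:
  assumes "rotation_matrix \<Lambda>"
  shows "mat_cross (\<Lambda> ** A) (\<Lambda> ** U) = \<Lambda> *v mat_cross A U"
  by (simp add: mat_cross_def sum_2 column_matrix_mult cross_rotation_matrix[OF assms]
      matrix_vector_right_distrib)

lemma vec_mat_cross_rotate:
  assumes "rotation_matrix \<Lambda>"
  shows "vec_mat_cross (\<Lambda> *v a) (\<Lambda> ** U) = \<Lambda> ** vec_mat_cross a U"
proof -
  have "jmat (\<Lambda> *v x) (\<Lambda> *v y) = \<Lambda> ** jmat x y" for x y
    by (simp add: jmat_def vec_eq_iff matrix_matrix_mult_def matrix_vector_mult_def)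
  then show ?thesis
    by (simp add: vec_mat_cross_def column_matrix_mult cross_rotation_matrix[OF assms])
qed

lemma vec_mat_cross_mult_right: "vec_mat_cross a (U ** M) = vec_mat_cross a U ** M"
  by (simp add: vec_mat_cross_def jmat_def sum_2 matrix_matrix_mult_def column_def
      vec_eq_iff forall_2 forall_3 cross3_def) (simp add: algebra_simps)

lemma matrix_inv_invertible:
  fixes M :: "real ^ 'n ^ 'n"
  assumes "invertible M"
  shows "M ** matrix_inv M = mat 1" and "matrix_inv M ** M = mat 1"
proof -
  have "M ** matrix_inv M = mat 1 \<and> matrix_inv M ** M = mat 1"
    using assms unfolding invertible_def matrix_inv_def by (rule someI_ex)
  then show "M ** matrix_inv M = mat 1" and "matrix_inv M ** M = mat 1"
    by simp_all
qed

lemma matrix_inv_eqI: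
  fixes M N :: "real ^ 'n ^ 'n"
  assumes "M ** N = mat 1"
  shows "matrix_inv M = N"
proof -
  have "invertible M"
    using assms by (auto simp: invertible_right_inverse)
  then have "N = (matrix_inv M ** M) ** N"
    by (simp add: matrix_inv_invertible)
  also have "\<dots> = matrix_inv M"
    by (simp add: assms matrix_mul_assoc[symmetric])
  finally show ?thesis ..
qed

lemma sym_pos_def_invertible:
  fixes M :: "real ^ 'n ^ 'n"
  assumes "sym_pos_def M"
  shows "invertible M"
proof -
  have "x = 0" if "M *v x = 0" for x
    using assms that by (metis inner_zero_right less_irrefl sym_pos_def_def)
  then show ?thesis
    by (simp add: invertible_left_inverse matrix_left_invertible_ker)
qed

text \<open>
  \<open>Psi \<Lambda> D\<close> is linear, so the following lemma says that it carries the vector field with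
  parameters \<open>P\<close> to the one with parameters \<open>psi \<Lambda> D P\<close>.
\<close>

lemma dg_field_psi:
  assumes P: "dg_problem P" and L: "rotation_matrix \<Lambda>" and D: "invertible D"
  shows "dg_field (psi \<Lambda> D P) (Psi \<Lambda> D z) = Psi \<Lambda> D (dg_field P z)"
proof -
  obtain \<omega> U where z: "z = (\<omega>, U)"
    by fastforce
  let ?I = "inertia P" and ?LT = "transpose \<Lambda>"
  have LT: "?LT ** \<Lambda> = mat 1" "\<Lambda> ** ?LT = mat 1"
    using L by (simp_all add: rotation_matrix_def orthogonal_matrix_def)
  have I: "invertible ?I"
    using P by (simp add: dg_problem_def sym_pos_def_invertible)
  have DD: "matrix_inv D ** D = mat 1"
    using D by (simp add: matrix_inv_invertible)
  have II: "?I ** matrix_inv ?I = mat 1"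
    using I by (simp add: matrix_inv_invertible)
  have "(\<Lambda> ** ?I ** ?LT) ** (\<Lambda> ** matrix_inv ?I ** ?LT) = mat 1"
  proof -
    have "?LT ** (\<Lambda> ** V) = V" and "?I ** (matrix_inv ?I ** V) = V" for V :: "real ^ 3 ^ 3"
      by (simp_all add: matrix_mul_assoc LT II)
    then show ?thesis
      by (simp add: matrix_mul_assoc[symmetric] LT)
  qed
  then have inv: "matrix_inv (\<Lambda> ** ?I ** ?LT) = \<Lambda> ** matrix_inv ?I ** ?LT"
    by (rule matrix_inv_eqI)
  have LTv: "?LT *v (\<Lambda> *v x) = x" for x
    by (simp add: matrix_vector_mul_assoc LT del: transpose_matrix_vector)
  have DT: "transpose D ** transpose (matrix_inv D) = mat 1"
    by (metis DD matrix_transpose_mul transpose_mat)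
  have cr: "mat_cross (\<Lambda> ** centers P ** matrix_inv D) (\<Lambda> ** U ** transpose D)
      = \<Lambda> *v mat_cross (centers P) U"
    by (metis mat_cross_move mat_cross_rotate[OF L] DT matrix_mul_assoc matrix_mul_rid)
  have ga: "cross3 ((\<Lambda> ** ?I ** ?LT) *v (\<Lambda> *v \<omega>) + \<Lambda> *v gyro P) (\<Lambda> *v \<omega>)
      = \<Lambda> *v cross3 (?I *v \<omega> + gyro P) \<omega>"
    by (simp add: matrix_vector_mul_assoc[symmetric] LTv matrix_vector_right_distrib[symmetric]
        cross_rotation_matrix[OF L] del: transpose_matrix_vector)
  have vc: "vec_mat_cross (\<Lambda> *v \<omega>) (\<Lambda> ** U ** transpose D)
      = \<Lambda> ** vec_mat_cross \<omega> U ** transpose D"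
    by (simp only: vec_mat_cross_mult_right vec_mat_cross_rotate[OF L])
  have neg: "\<Lambda> ** (- V) ** M = - (\<Lambda> ** V ** M)" for V :: "real ^ 2 ^ 3" and M :: "real ^ 2 ^ 2"
    by (simp add: vec_eq_iff matrix_matrix_mult_def sum_negf)
  have tr: "(\<Lambda> ** matrix_inv ?I ** ?LT) *v (\<Lambda> *v v + \<Lambda> *v w)
      = \<Lambda> *v (matrix_inv ?I *v (v + w))" for v w
    by (simp only: matrix_vector_right_distrib[symmetric] matrix_vector_mul_assoc[symmetric] LTv)
  show ?thesis
    by (simp only: z dg_field_def Psi_def psi_def dg_params.simps prod.case inv cr ga vc neg tr)
qed

end

theory Submission
  imports Defs
begin

text \<open>
  Let \<open>A\<close> be the matrix of the centers and \<open>C\<close> the Gram matrix of the intensities. The problem is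
  one of finding a good orthonormal basis \<open>u, v\<close> of the plane \<open>\<Pi>\<close> spanned by the columns of \<open>A\<close>.
  Given such a basis, put \<open>W = jmat u v\<close>. Let \<open>\<Lambda>\<close> be the rotation that takes \<open>u, v\<close> to
  \<open>e\<^sub>1, e\<^sub>2\<close>, and let \<open>D = W\<^sup>T A\<close> be the coordinate matrix of the centers, so that \<open>A = W D\<close>.
  Then \<open>\<Lambda> A D\<^sup>-\<^sup>1 = \<Lambda> W\<close> has columns \<open>e\<^sub>1, e\<^sub>2\<close> whatever the basis was. The new Gram matrix is
  \<open>D C D\<^sup>T = W\<^sup>T (A C A\<^sup>T) W\<close>, which is the matrix of the quadratic form with symmetric matrix
  \<open>A C A\<^sup>T\<close>, restricted to \<open>\<Pi>\<close>, in the basis \<open>u, v\<close>. Hence the problem is canonical as soon as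
  \<open>u, v\<close> are principal axes of this form, and those exist
  (\<open>orthonormal_pair_diagonalizing_form\<close>). Independence of the centers is what makes \<open>\<Pi>\<close> a plane
  and \<open>D\<close> invertible. The planes correspond because multiplying a matrix on the right by an
  invertible one does not change its column space.
\<close>

section \<open>Principal axes of a quadratic form on a plane\<close>

text \<open>
  If a quadratic form has diagonal entries \<open>p, q\<close> and off-diagonal entry \<open>r\<close> in an orthonormal basis
  of a plane, the expression below is its off-diagonal entry in the basis turned by the angle with
  cosine \<open>c\<close> and sine \<open>s\<close>. A right angle changes its sign, so it vanishes at some angle between.
\<close>

lemma rotation_diagonalizing:
  fixes p q r :: real
  obtains c s where "c\<^sup>2 + s\<^sup>2 = 1" "c * s * (q - p) + (c\<^sup>2 - s\<^sup>2) * r = 0"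
proof -
  let ?f = "\<lambda>t. cos t * sin t * (q - p) + ((cos t)\<^sup>2 - (sin t)\<^sup>2) * r"
  have cont: "continuous_on {0..pi/2} ?f"
    by (intro continuous_intros)
  have ends: "?f 0 = r" "?f (pi/2) = - r"
    by simp_all
  have "\<exists>t. ?f t = 0"
  proof (cases "r \<le> 0")
    case True
    then show ?thesis
      using IVT'[of ?f 0 0 "pi/2"] cont ends by auto
  next
    case False
    then show ?thesis
      using IVT2'[of ?f "pi/2" 0 0] cont ends by auto
  qed
  then obtain t where "?f t = 0" ..
  then show thesis
    using that[of "cos t" "sin t"] by simp
qed

lemma orthonormal_pair_of_independent:
  fixes a b :: "real ^ 3"
  assumes "cross3 a b \<noteq> 0"
  obtains u v where "norm u = 1" "norm v = 1" "u \<bullet> v = 0" "span {u, v} = span {a, b}"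
proof -
  have ncol: "a \<noteq> 0" "\<And>c. b \<noteq> c *\<^sub>R a"
    using assms by (auto simp: cross_eq_0 collinear_lemma)
  have ne: "a \<noteq> b"
    using ncol(2)[of 1] by simp
  have "independent {b, a}"
    using ncol ne by (auto simp: independent_insert span_singleton)
  then have dim: "dim (span {a, b}) = 2"
    using ne by (simp add: dim_eq_card_independent insert_commute)
  obtain B where B: "pairwise orthogonal B" "\<And>x. x \<in> B \<Longrightarrow> norm x = 1"
      "card B = 2" "span B = span {a, b}"
    using orthonormal_basis_subspace[of "span {a, b}"] dim by (metis subspace_span)
  then obtain u v where "B = {u, v}" "u \<noteq> v"
    by (meson card_2_iff)
  then show thesis
    using B that[of u v] by (auto simp: pairwise_def orthogonal_def)
qed

text \<open>
  The spectral theorem for the form \<open>S\<close> on the plane of \<open>a\<close> and \<open>b\<close>: principal axes arise by turning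
  an arbitrary orthonormal basis of the plane by a suitable angle.
\<close>

lemma orthonormal_pair_diagonalizing_form:
  fixes a b :: "real ^ 3" and S :: "real ^ 3 ^ 3"
  assumes "cross3 a b \<noteq> 0" and S: "transpose S = S"
  obtains u v where "norm u = 1" "norm v = 1" "u \<bullet> v = 0"
    "a \<in> span {u, v}" "b \<in> span {u, v}" "u \<bullet> (S *v v) = 0"
proof -
  obtain x y where xy: "norm x = 1" "norm y = 1" "x \<bullet> y = 0" and sp: "span {x, y} = span {a, b}"
    using orthonormal_pair_of_independent[OF assms(1)] .
  have sym: "y \<bullet> (S *v x) = x \<bullet> (S *v y)"
    using S by (metis dot_lmul_matrix inner_commute vector_transpose_matrix)
  obtain c s where cs1: "c\<^sup>2 + s\<^sup>2 = 1" and form: "c * s * (y \<bullet> (S *v y) - x \<bullet> (S *v x))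
      + (c\<^sup>2 - s\<^sup>2) * (x \<bullet> (S *v y)) = 0"
    using rotation_diagonalizing .
  define u where "u = c *\<^sub>R x + s *\<^sub>R y"
  define v where "v = (- s) *\<^sub>R x + c *\<^sub>R y"
  have xx: "x \<bullet> x = 1" "y \<bullet> y = 1" "y \<bullet> x = 0"
    using xy by (simp_all add: norm_eq_1 inner_commute)
  have cs: "c * c + s * s = 1"
    using cs1 by (simp add: power2_eq_square)
  have "u \<bullet> u = 1" "v \<bullet> v = 1" "u \<bullet> v = 0"
    using cs xx xy by (simp_all add: u_def v_def inner_add_left inner_add_right inner_diff_left inner_diff_right)
  then have on: "norm u = 1" "norm v = 1" "u \<bullet> v = 0"
    by (simp_all add: norm_eq_1)
  have "c *\<^sub>R u - s *\<^sub>R v = (c * c + s * s) *\<^sub>R x"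
    "s *\<^sub>R u + c *\<^sub>R v = (c * c + s * s) *\<^sub>R y"
    by (simp_all add: u_def v_def vec_eq_iff algebra_simps)
  then have "x = c *\<^sub>R u - s *\<^sub>R v" "y = s *\<^sub>R u + c *\<^sub>R v"
    by (simp_all add: cs)
  moreover have "u \<in> span {u, v}" "v \<in> span {u, v}"
    by (simp_all add: span_base)
  ultimately have "x \<in> span {u, v}" "y \<in> span {u, v}"
    by (metis span_add span_diff span_scale)+
  then have "span {a, b} \<subseteq> span {u, v}"
    unfolding sp[symmetric] by (intro span_minimal) auto
  then have "a \<in> span {u, v}" "b \<in> span {u, v}"
    by (auto intro: span_base)
  moreover have "u \<bullet> (S *v v) = 0"
  proof -
    have "S *v v = (- s) *\<^sub>R (S *v x) + c *\<^sub>R (S *v y)"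
      by (simp only: v_def matrix_vector_right_distrib matrix_vector_mult_scaleR)
    then have Sv: "S *v v = c *\<^sub>R (S *v y) - s *\<^sub>R (S *v x)"
      by simp
    have "u \<bullet> (S *v v) = c * s * (y \<bullet> (S *v y) - x \<bullet> (S *v x))
      + (c\<^sup>2 - s\<^sup>2) * (x \<bullet> (S *v y))"
      by (simp add: Sv u_def inner_add_left inner_diff_right sym power2_eq_square algebra_simps)
    then show ?thesis
      using form by simp
  qed
  ultimately show thesis
    using on that by blast
qed

section \<open>Rotations and orthonormal pairs\<close>

text \<open>The vector product supplies the third row of the rotation, with the right orientation.\<close>

lemma rotation_to_axes:
  fixes u v :: "real ^ 3"
  assumes "norm u = 1" "norm v = 1" "u \<bullet> v = 0"
  obtains \<Lambda> where "rotation_matrix \<Lambda>" "\<Lambda> *v u = axis 1 1" "\<Lambda> *v v = axis 2 1"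
proof -
  define \<Lambda> :: "real ^ 3 ^ 3" where "\<Lambda> = vector [u, v, cross3 u v]"
  have rows: "row 1 \<Lambda> = u" "row 2 \<Lambda> = v" "row 3 \<Lambda> = cross3 u v"
    by (simp_all add: \<Lambda>_def row_def)
  have n3: "norm (cross3 u v) = 1"
    using norm_cross_dot[of u v] assms by (simp add: power2_eq_1_iff) (smt (verit) norm_ge_zero)
  have "orthogonal_matrix \<Lambda>"
    unfolding orthogonal_matrix_orthonormal_rows
    using assms n3 by (simp add: forall_3 rows orthogonal_def dot_cross_self inner_commute)
  moreover have "det \<Lambda> = 1"
  proof -
    have "det \<Lambda> = u \<bullet> cross3 v (cross3 u v)"
      by (simp add: \<Lambda>_def dot_cross_det)
    also have "\<dots> = (norm (cross3 u v))\<^sup>2"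
      unfolding power2_norm_eq_inner by (simp add: cross3_simps)
    finally show ?thesis
      by (simp add: n3)
  qed
  ultimately have "rotation_matrix \<Lambda>"
    by (simp add: rotation_matrix_def)
  moreover have "(\<Lambda> *v x) $ i = row i \<Lambda> \<bullet> x" for x i
    by (simp add: matrix_vector_mul_component row_def)
  then have "\<Lambda> *v u = axis 1 1" "\<Lambda> *v v = axis 2 1"
    using assms by (simp_all add: vec_eq_iff forall_3 rows axis_def dot_cross_self norm_eq_1 inner_commute)
  ultimately show thesis
    using that by blast
qed

section \<open>Column spaces and changes of basis\<close>

lemma span_columns_eq_range:
  fixes M :: "real ^ 2 ^ 'n"
  shows "span {column 1 M, column 2 M} = range ((*v) M)"
proof -
  have M: "M *v x = x $ 1 *\<^sub>R column 1 M + x $ 2 *\<^sub>R column 2 M" for x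
    by (simp add: vec_eq_iff matrix_vector_mult_def column_def sum_2 mult.commute)
  show ?thesis
  proof (intro equalityI subsetI)
    fix y assume "y \<in> span {column 1 M, column 2 M}"
    then obtain k l where "y = k *\<^sub>R column 1 M + l *\<^sub>R column 2 M"
      by (auto simp: span_insert span_singleton algebra_simps)
    then have "y = M *v vector [k, l]"
      by (simp add: M)
    then show "y \<in> range ((*v) M)"
      by blast
  next
    fix y assume "y \<in> range ((*v) M)"
    then obtain x where x: "y = M *v x"
      by blast
    have "column 1 M \<in> span {column 1 M, column 2 M}" "column 2 M \<in> span {column 1 M, column 2 M}"
      by (simp_all add: span_base)
    then show "y \<in> span {column 1 M, column 2 M}"
      unfolding x M by (rule span_add[OF span_scale span_scale])
  qed
qed

lemma range_mult_invertible:
  fixes M :: "real ^ 'n ^ 'm" and N :: "real ^ 'n ^ 'n"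
  assumes "invertible N"
  shows "range ((*v) (M ** matrix_inv N)) = range ((*v) M)"
proof -
  have "M *v x = (M ** matrix_inv N) *v (N *v x)" for x
    by (simp add: matrix_vector_mul_assoc matrix_mul_assoc[symmetric] matrix_inv_invertible[OF assms])
  then show ?thesis
    by (auto simp: matrix_vector_mul_assoc[symmetric])
qed

lemma sym_pos_def_rotate:
  assumes "rotation_matrix \<Lambda>" and "sym_pos_def M"
  shows "sym_pos_def (\<Lambda> ** M ** transpose \<Lambda>)"
proof -
  have LT: "\<Lambda> ** transpose \<Lambda> = mat 1"
    using assms by (simp add: rotation_matrix_def orthogonal_matrix_def)
  have nz: "transpose \<Lambda> *v x \<noteq> 0" if "x \<noteq> 0" for x
    using that LT by (metis matrix_vector_mul_assoc matrix_vector_mul_lid matrix_vector_mult_0_right)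
  have "x \<bullet> ((\<Lambda> ** M ** transpose \<Lambda>) *v x) = (transpose \<Lambda> *v x) \<bullet> (M *v (transpose \<Lambda> *v x))" for x
    by (metis dot_lmul_matrix matrix_vector_mul_assoc transpose_matrix_vector)
  then show ?thesis
    using assms nz by (simp add: sym_pos_def_def matrix_transpose_mul matrix_mul_assoc del: transpose_matrix_vector)
qed

text \<open>
  For an orthonormal pair \<open>u, v\<close>, the matrix \<open>jmat u v ** transpose (jmat u v)\<close> is the orthogonal
  projection onto the plane of \<open>u\<close> and \<open>v\<close>, so it fixes the columns of \<open>A\<close>.
\<close>

lemma orthonormal_pair_expansion:
  fixes A :: "real ^ 2 ^ 3"
  assumes "norm u = 1" "norm v = 1" "u \<bullet> v = 0"
    and "column 1 A \<in> span {u, v}" "column 2 A \<in> span {u, v}"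
  shows "transpose (jmat u v) ** jmat u v = mat 1"
    and "jmat u v ** (transpose (jmat u v) ** A) = A"
proof -
  let ?W = "jmat u v"
  have col: "column 1 ?W = u" "column 2 ?W = v"
    by (simp_all add: jmat_def column_def vec_eq_iff)
  have entries: "(transpose ?W ** ?W) $ i $ j = column i ?W \<bullet> column j ?W" for i j
    by (simp add: inner_vec_def matrix_matrix_mult_def transpose_def column_def)
  show WW: "transpose ?W ** ?W = mat 1"
    using assms by (simp add: vec_eq_iff forall_2 entries col mat_def norm_eq_1 inner_commute)
  have fixed: "(?W ** transpose ?W) *v y = y" if "y \<in> span {u, v}" for y
  proof -
    have "y \<in> range ((*v) ?W)"
      using that span_columns_eq_range[of ?W] by (simp add: col)
    then obtain x where x: "y = ?W *v x"
      by blast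
    have "(?W ** transpose ?W) *v (?W *v x) = (?W ** (transpose ?W ** ?W)) *v x"
      by (simp only: matrix_vector_mul_assoc matrix_mul_assoc)
    then show ?thesis
      by (simp add: x WW)
  qed
  have "column k (?W ** (transpose ?W ** A)) = column k A" for k :: 2
    using exhaust_2[of k] fixed[OF assms(4)] fixed[OF assms(5)]
    by (elim disjE) (simp_all only: matrix_mul_assoc column_matrix_mult)
  then show "?W ** (transpose ?W ** A) = A"
    by (simp add: column_def vec_eq_iff)
qed

section \<open>Reduction to canonical form\<close>

theorem theorem1:
  fixes P :: dg_params
  assumes "dg_problem P" and "dg_independent P"
  shows "\<exists>(\<Lambda> :: real ^ 3 ^ 3) (D :: real ^ 2 ^ 2).
           rotation_matrix \<Lambda> \<and> invertible D \<and>
           dg_canonical (psi \<Lambda> D P) \<and>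
           (\<lambda>x. \<Lambda> *v x) ` span {column 1 (centers P), column 2 (centers P)} =
             span {column 1 (centers (psi \<Lambda> D P)), column 2 (centers (psi \<Lambda> D P))}"
proof -
  define A where "A = centers P"
  define C where "C = gram P"
  have indep: "cross3 (column 1 A) (column 2 A) \<noteq> 0" and C: "transpose C = C"
    using assms by (simp_all add: A_def C_def dg_problem_def dg_independent_def)
  have "transpose (A ** C ** transpose A) = A ** C ** transpose A"
    by (simp add: matrix_transpose_mul matrix_mul_assoc C)
  with indep obtain u v where uv: "norm u = 1" "norm v = 1" "u \<bullet> v = 0"
      and plane: "column 1 A \<in> span {u, v}" "column 2 A \<in> span {u, v}"
      and diag: "u \<bullet> ((A ** C ** transpose A) *v v) = 0"
    by (rule orthonormal_pair_diagonalizing_form)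
  obtain \<Lambda> where \<Lambda>: "rotation_matrix \<Lambda>" "\<Lambda> *v u = axis 1 1" "\<Lambda> *v v = axis 2 1"
    using rotation_to_axes[OF uv] .
  define W where "W = jmat u v"
  define D where "D = transpose W ** A"
  have W: "column 1 W = u" "column 2 W = v"
    by (simp_all add: W_def jmat_def column_def vec_eq_iff)
  have WW: "transpose W ** W = mat 1" and WD: "W ** D = A"
    using orthonormal_pair_expansion[OF uv plane] by (simp_all add: W_def D_def)
  have D: "invertible D"
  proof -
    \<comment> \<open>As \<open>W\<close> is an isometry, \<open>D\<close> has the Gram matrix of \<open>A = W D\<close>, which is nonsingular.\<close>
    have "transpose D ** D = transpose A ** A"
      by (metis D_def WD matrix_mul_assoc matrix_transpose_mul transpose_transpose)
    moreover have "sym_pos_def (transpose A ** A)"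
      using intensities_independent_iff[of A "transpose A ** A"] indep by (simp add: orbit_def)
    ultimately have "invertible (transpose D ** D)"
      by (simp add: sym_pos_def_invertible)
    then show ?thesis
      by (metis invertible_left_inverse invertible_def matrix_mul_assoc)
  qed
  have centers: "\<Lambda> ** A ** matrix_inv D = \<Lambda> ** W"
    by (metis D WD matrix_inv_invertible(1) matrix_mul_assoc matrix_mul_rid)
  have sym: "transpose (D ** C ** transpose D) = D ** C ** transpose D"
    by (simp add: matrix_transpose_mul matrix_mul_assoc C)
  \<comment> \<open>The new Gram matrix is that of the form \<open>A ** C ** transpose A\<close> in the basis \<open>u, v\<close>.\<close>
  have gram: "D ** C ** transpose D = transpose W ** ((A ** C ** transpose A) ** W)"
    by (simp add: D_def matrix_transpose_mul matrix_mul_assoc)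
  have "(transpose W ** (M ** W)) $ i $ j = column i W \<bullet> (M *v column j W)" for M i j
    unfolding column_matrix_mult[symmetric]
    by (simp add: inner_vec_def matrix_matrix_mult_def transpose_def column_def)
  then have off: "(D ** C ** transpose D) $ 1 $ 2 = 0"
    using diag by (simp only: gram W)
  moreover have "(D ** C ** transpose D) $ 2 $ 1 = (D ** C ** transpose D) $ 1 $ 2"
    by (subst sym[symmetric]) (simp only: transpose_def vec_lambda_beta)
  ultimately have offdiag: "\<forall>i j. i \<noteq> j \<longrightarrow> (D ** C ** transpose D) $ i $ j = 0"
    by (simp add: forall_2)
  have "dg_canonical (psi \<Lambda> D P)"
    using assms(1) sym offdiag \<Lambda> sym_pos_def_rotate[OF \<Lambda>(1)] centers
    by (simp add: dg_canonical_def dg_problem_def psi_def A_def C_def column_matrix_mult W)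
  moreover have "(\<lambda>x. \<Lambda> *v x) ` range ((*v) A) = range ((*v) (\<Lambda> ** A ** matrix_inv D))"
    unfolding range_mult_invertible[OF D] by (simp add: image_image matrix_vector_mul_assoc)
  ultimately show ?thesis
    using \<Lambda>(1) D by (intro exI[of _ \<Lambda>] exI[of _ D]) (simp add: span_columns_eq_range psi_def A_def)
qed

end
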